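(* Let $L, R$ be subsets of a group $G$ such that $(L,R)$ has the $2$S-Cayley property, and suppose that $\Gamma=\mathrm{2SCay}(G;L,R)$ is connected and regular of prime valency $p$. Then either $\Gamma$ is a Cayley graph, or $p$ is odd and the following all hold, up to interchanging $L$ and $R$: (a) $R=\{r\}$, where $r$ lies in a $G$-conjugacy class $\mathcal{C}$ of non-central elements; (b) $G=\langle L\rangle$, $|L|=p$, and $L\cap\mathcal{C}=\varnothing$. Moreover, if $G$ is abelian or if $G$ is dihedral of twice-odd order (i.e. of order $2n$ with $n$ odd), then $\Gamma$ is a Cayley graph.
   Context: Let $G$ be a group with identity $e$; for $X\subseteq G$ and $g\in G$ write $X^{-1}=\{x^{-1}: x\in X\}$, $X^g=g^{-1}Xg$, and $XY=\{xy: x\in X, y\in Y\}$; $\langle X\rangle$ is the subgroup generated by $X$. For non-empty subsets $L,R$ of $G$, the two-sided Cayley graph $\mathrm{2SCay}(G;L,R)$ is the directed graph with vertex set $G$ with an arc from $x$ to $y$ if and only if $y=\ell^{-1}xr$ for some $\ell\in L$, $r\in R$. If the adjacency relation is symmetric, it is regarded as an undirected graph. A pair $(L,R)$ of subsets of $G$ has the $2$S-Cayley property if both $L,R$ are non-empty and: (1) $L^{-1}gR=LgR^{-1}$ for each $g\in G$ (this makes the adjacency relation symmetric); (2) $L^g\cap R=\varnothing$ for each $g\in G$; (3) $(LL^{-1})^g\cap (RR^{-1})=\{e\}$ for each $g\in G$. For a group $H$ and a subset $S\subseteq H$ with $e\notin S$ and $S=S^{-1}$, the Cayley graph $\mathrm{Cay}(H,S)$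 is the graph with vertex set $H$ such that $(x,y)$ is an arc iff $xy^{-1}\in S$. A graph "is a Cayley graph" if it is isomorphic to $\mathrm{Cay}(H,S)$ for some group $H$ and some such $S$ (the group $H$ need not be $G$). *)

theory Defs
  imports
    "HOL-Algebra.Generated_Groups"
    "HOL-Computational_Algebra.Primes"
    "Graph_Theory.Digraph_Isomorphism"
    "Graph_Theory.Pair_Digraph"
begin

text \<open>
  Graphs are symmetric digraphs, given as pair digraphs (arcs are ordered pairs of vertices).
\<close>

definition twosided_cayley ::
  "('a, 'b) monoid_scheme \<Rightarrow> 'a set \<Rightarrow> 'a set \<Rightarrow> 'a pair_pre_digraph" where
  "twosided_cayley G L R = \<lparr>
     pverts = carrier G,
     parcs = {(x, y). x \<in> carrier G \<and> y \<in> carrier G \<and>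
                (\<exists>l\<in>L. \<exists>r\<in>R. y = inv\<^bsub>G\<^esub> l \<otimes>\<^bsub>G\<^esub> x \<otimes>\<^bsub>G\<^esub> r)} \<rparr>"

definition conj_set :: "('a, 'b) monoid_scheme \<Rightarrow> 'a set \<Rightarrow> 'a \<Rightarrow> 'a set" where
  "conj_set G X g = inv\<^bsub>G\<^esub> g <#\<^bsub>G\<^esub> X #>\<^bsub>G\<^esub> g"

definition twosided_cayley_property ::
  "('a, 'b) monoid_scheme \<Rightarrow> 'a set \<Rightarrow> 'a set \<Rightarrow> bool" where
  "twosided_cayley_property G L R \<longleftrightarrow>
     L \<subseteq> carrier G \<and> R \<subseteq> carrier G \<and> L \<noteq> {} \<and> R \<noteq> {} \<and>
     (\<forall>g\<in>carrier G. set_inv\<^bsub>G\<^esub> L #>\<^bsub>G\<^esub> g <#>\<^bsub>G\<^esub> R = L #>\<^bsub>G\<^esub> g <#>\<^bsub>G\<^esub> set_inv\<^bsub>G\<^esub> R) \<and>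
     (\<forall>g\<in>carrier G. conj_set G L g \<inter> R = {}) \<and>
     (\<forall>g\<in>carrier G. conj_set G (L <#>\<^bsub>G\<^esub> set_inv\<^bsub>G\<^esub> L) g \<inter> (R <#>\<^bsub>G\<^esub> set_inv\<^bsub>G\<^esub> R) = {\<one>\<^bsub>G\<^esub>})"

definition cayley_graph :: "('a, 'b) monoid_scheme \<Rightarrow> 'a set \<Rightarrow> 'a pair_pre_digraph" where
  "cayley_graph H S = \<lparr>
     pverts = carrier H,
     parcs = {(x, y). x \<in> carrier H \<and> y \<in> carrier H \<and> x \<otimes>\<^bsub>H\<^esub> inv\<^bsub>H\<^esub> y \<in> S} \<rparr>"

text \<open>
  The group \<open>H\<close> is arbitrary. Taking its elements in the vertex type is no restriction:
  an isomorphism onto \<open>cayley_graph H S\<close> is a bijection from the vertices onto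
  the carrier of \<open>H\<close>, along which the group structure can be transported.
\<close>

definition is_cayley_graph :: "'a pair_pre_digraph \<Rightarrow> bool" where
  "is_cayley_graph \<Gamma> \<longleftrightarrow>
     (\<exists>(H :: 'a monoid) S. group H \<and> S \<subseteq> carrier H \<and> \<one>\<^bsub>H\<^esub> \<notin> S \<and> set_inv\<^bsub>H\<^esub> S = S \<and>
        digraph_iso (with_proj \<Gamma>) (with_proj (cayley_graph H S)))"

text \<open>
  Meant for symmetric loopless digraphs, where the out-degree is the valency.
  Finiteness is required because \<^const>\<open>out_degree\<close> is 0 for infinitely many arcs.
\<close>

definition regular_of_valency :: "'a pair_pre_digraph \<Rightarrow> nat \<Rightarrow> bool" where
  "regular_of_valency \<Gamma> k \<longleftrightarrow>
     (\<forall>v\<in>pverts \<Gamma>. finite (out_arcs (with_proj \<Gamma>) v) \<and> out_degree (with_proj \<Gamma>) v = k)"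

definition conj_class :: "('a, 'b) monoid_scheme \<Rightarrow> 'a \<Rightarrow> 'a set" where
  "conj_class G x = {inv\<^bsub>G\<^esub> g \<otimes>\<^bsub>G\<^esub> x \<otimes>\<^bsub>G\<^esub> g | g. g \<in> carrier G}"

definition group_centre :: "('a, 'b) monoid_scheme \<Rightarrow> 'a set" where
  "group_centre G = {z \<in> carrier G. \<forall>x\<in>carrier G. z \<otimes>\<^bsub>G\<^esub> x = x \<otimes>\<^bsub>G\<^esub> z}"

text \<open>
  The dihedral group of order \<open>2n\<close> (for \<open>n \<ge> 1\<close>): the pair \<open>(i, s)\<close> stands for
  \<open>\<rho>\<^sup>i\<close> if \<open>s\<close> is false and for \<open>\<rho>\<^sup>i \<sigma>\<close> if \<open>s\<close> is true, where \<open>\<rho>\<close> is the rotation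
  of order \<open>n\<close>, \<open>\<sigma>\<close> is a reflection and \<open>\<sigma> \<rho> \<sigma> = \<rho>\<^sup>-\<^sup>1\<close>.
\<close>

definition dihedral_group :: "nat \<Rightarrow> (int \<times> bool) monoid" where
  "dihedral_group n = \<lparr>
     carrier = {0..<int n} \<times> UNIV,
     monoid.mult = (\<lambda>(i, s) (j, t). ((if s then i - j else i + j) mod int n, s \<noteq> t)),
     one = (0, False) \<rparr>"

lemma group_dihedral_group:
  assumes "n > 0"
  shows "group (dihedral_group n)"
proof (rule groupI, goal_cases)
  case (3 x y z)
  then show ?case
    by (auto simp: dihedral_group_def mod_simps algebra_simps)
next
  case (5 x)
  then show ?case using assms
    by (intro bexI[of _ "if snd x then x else ((- fst x) mod int n, False)"])
      (auto simp: dihedral_group_def mod_simps split: prod.splits if_splits)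
qed (use assms in \<open>auto simp: dihedral_group_def\<close>)

lemma order_dihedral_group: "order (dihedral_group n) = 2 * n"
  by (simp add: order_def dihedral_group_def card_cartesian_product)

end

theory Submission
  imports Defs
begin

text \<open>
  By the third defining condition, the arcs leaving a vertex correspond to the pairs in
  \<open>L \<times> R\<close>, so \<open>|L| |R| = p\<close> and one of the two sets is a singleton. Inversion is an isomorphism
  between the graphs of \<open>(L, R)\<close> and \<open>(R, L)\<close>, so let \<open>R = {r}\<close> and \<open>|L| = p\<close>. From then on only
  the following is used: the steps \<open>x \<mapsto> l\<^sup>-\<^sup>1 x r\<close> define a symmetric, loopless and connected graph.
  If \<open>r\<close> is central, a step is left multiplication by \<open>l\<^sup>-\<^sup>1 r\<close>, and the graph is a Cayley
  graph of \<open>G\<close>.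

  Symmetry gives \<open>L\<^sup>-\<^sup>1 w = L\<close> for every conjugate \<open>w\<close> of \<open>r\<^sup>2\<close>. Let \<open>E\<close> be the subgroup generated by
  \<open>L\<^sup>-\<^sup>1 L\<close>; as \<open>L = L\<^sup>-\<^sup>1 r\<^sup>2\<close>, it consists of the vertices that walks of even length reach from the
  identity. Connectedness shows that \<open>G = E \<union> E l\<^sup>-\<^sup>1 r\<close> (\<open>even_or_shifted_even\<close>), so \<open>E\<close> has
  index at most two.

  \<^item> If \<open>r\<^sup>2\<close> is not central, the right stabiliser of \<open>L\<close> contains the nontrivial quotients of
    conjugates of \<open>r\<^sup>2\<close>. Its order divides the prime \<open>|L|\<close>, so \<open>L\<close> is a coset of it, and \<open>L\<close> is a
    coset of \<open>E\<close> as well. Then \<open>E \<noteq> G\<close> because the graph has no loops, and the arcs are all pairs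
    that \<open>E\<close> separates: the graph is complete bipartite, and is the Cayley graph of \<open>G\<close> with
    respect to \<open>G - E\<close> (\<open>is_cayley_graph_square_noncentral\<close>).
  \<^item> If \<open>r\<^sup>2\<close> is central and \<open>E \<noteq> G\<close>, the permutations \<open>x \<mapsto> e x\<close> for \<open>e \<in> E\<close> and
    \<open>x \<mapsto> g r\<^sup>-\<^sup>1 x r\<close> for \<open>g \<notin> E\<close> form a group that is regular on the vertices and contains every
    step (\<open>is_cayley_graph_square_central\<close>).
  \<^item> If \<open>r\<^sup>2\<close> is central and \<open>E = G\<close>, then \<open>L\<close> generates \<open>G\<close>. For \<open>L = {a, b}\<close> the group
    \<open>E = \<langle>a\<^sup>-\<^sup>1 b\<rangle>\<close> is cyclic, which makes \<open>r\<close> central. Hence the graph is a Cayley graph or \<open>p\<close> is odd.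

  So in the exceptional case \<open>r\<close> is not central, but \<open>r\<^sup>2\<close> is. This excludes abelian groups. In a
  dihedral group of twice-odd order it makes \<open>r\<close> a reflection; all reflections are conjugate, and
  no conjugate of \<open>r\<close> lies in \<open>L\<close> because the graph has no loops. So \<open>L\<close> consists of rotations and
  does not generate \<open>G\<close> (\<open>generate_proper_dihedral_group\<close>).
\<close>

section \<open>Stable sets and commuting generators\<close>

lemma (in group) inv_cancel_left:
  assumes "x \<in> carrier G" "y \<in> carrier G"
  shows "inv x \<otimes> (x \<otimes> y) = y" "x \<otimes> (inv x \<otimes> y) = y"
  using assms by (simp_all add: m_assoc [symmetric])

lemma (in group) generate_commute:
  assumes S: "S \<subseteq> carrier G" and z: "z \<in> carrier G"
    and comm: "\<And>s. s \<in> S \<Longrightarrow> z \<otimes> s = s \<otimes> z"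
    and x: "x \<in> generate G S"
  shows "z \<otimes> x = x \<otimes> z"
proof -
  have inv_comm: "z \<otimes> inv s = inv s \<otimes> z" if "s \<in> S" for s
  proof -
    have s: "s \<in> carrier G" using that S by auto
    have "inv s \<otimes> (z \<otimes> s) \<otimes> inv s = inv s \<otimes> (s \<otimes> z) \<otimes> inv s"
      using comm[OF that] by simp
    with s z show ?thesis by (simp add: m_assoc inv_cancel_left)
  qed
  from x show ?thesis
  proof induction
    case (eng h1 h2)
    have h: "h1 \<in> carrier G" "h2 \<in> carrier G"
      using eng S generate_in_carrier by auto
    have "z \<otimes> (h1 \<otimes> h2) = z \<otimes> h1 \<otimes> h2"
      using h z by (simp add: m_assoc)
    also have "\<dots> = h1 \<otimes> (z \<otimes> h2)" using h z eng by (simp add: m_assoc)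
    also have "\<dots> = h1 \<otimes> h2 \<otimes> z" using h z eng by (simp add: m_assoc)
    finally show ?case .
  qed (use z comm inv_comm in auto)
qed

text \<open>
  The set \<open>L\<close> is a disjoint union of left cosets of \<open>K\<close>.
\<close>
lemma (in group) card_subgroup_dvd_card_stable_set:
  assumes K: "subgroup K G" and L: "L \<subseteq> carrier G" "finite L"
    and stable: "\<And>l k. l \<in> L \<Longrightarrow> k \<in> K \<Longrightarrow> l \<otimes> k \<in> L"
  shows "card K dvd card L"
proof -
  interpret K: subgroup K G by fact
  define C where "C = (\<lambda>l. (\<lambda>k. l \<otimes> k) ` K) ` L"
  have union: "\<Union>C = L"
  proof
    show "\<Union>C \<subseteq> L" using stable by (auto simp: C_def)
    show "L \<subseteq> \<Union>C"
    proof
      fix l assume l: "l \<in> L"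
      then have "l \<in> (\<lambda>k. l \<otimes> k) ` K" using L by (intro image_eqI[of _ _ \<one>]) auto
      then show "l \<in> \<Union>C" using l by (auto simp: C_def)
    qed
  qed
  have coset_eq: "(\<lambda>k. a \<otimes> k) ` K = (\<lambda>k. b \<otimes> k) ` K"
    if ab: "a \<in> L" "b \<in> L" and z: "a \<otimes> k = b \<otimes> m" "k \<in> K" "m \<in> K" for a b k m
  proof -
    have c: "a \<in> carrier G" "b \<in> carrier G" "k \<in> carrier G" "m \<in> carrier G"
      using ab z L by auto
    have "a = b \<otimes> (m \<otimes> inv k)"
      using z c by (simp add: inv_solve_right flip: m_assoc)
    moreover have "(\<lambda>j. b \<otimes> (m \<otimes> inv k) \<otimes> j) ` K = (\<lambda>j. b \<otimes> j) ` K"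
    proof (intro equalityI subsetI)
      fix y assume "y \<in> (\<lambda>j. b \<otimes> (m \<otimes> inv k) \<otimes> j) ` K"
      then obtain j where j: "j \<in> K" "y = b \<otimes> (m \<otimes> inv k) \<otimes> j" by auto
      then have "y = b \<otimes> (m \<otimes> inv k \<otimes> j)" using c by (simp add: m_assoc)
      then show "y \<in> (\<lambda>j. b \<otimes> j) ` K" using j z by blast
    next
      fix y assume "y \<in> (\<lambda>j. b \<otimes> j) ` K"
      then obtain j where j: "j \<in> K" "y = b \<otimes> j" by auto
      then have "y = b \<otimes> (m \<otimes> inv k) \<otimes> (k \<otimes> inv m \<otimes> j)"
        using c by (simp add: m_assoc inv_cancel_left)
      then show "y \<in> (\<lambda>j. b \<otimes> (m \<otimes> inv k) \<otimes> j) ` K" using j z by blast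
    qed
    ultimately show ?thesis by simp
  qed
  have "card K * card C = card (\<Union>C)"
  proof (rule card_partition)
    show "finite C" using L by (simp add: C_def)
    show "finite (\<Union>C)" using union L by simp
    fix c assume "c \<in> C"
    then obtain l where l: "l \<in> L" "c = (\<lambda>k. l \<otimes> k) ` K" by (auto simp: C_def)
    show "card c = card K"
      unfolding l(2) using l(1) L by (intro card_image inj_onI) (auto simp: subset_iff)
  next
    fix c d assume "c \<in> C" "d \<in> C" "c \<noteq> d"
    then obtain a b where ab: "a \<in> L" "b \<in> L" "c = (\<lambda>k. a \<otimes> k) ` K" "d = (\<lambda>k. b \<otimes> k) ` K"
      by (auto simp: C_def)
    show "c \<inter> d = {}"
      using coset_eq[OF ab(1,2)] \<open>c \<noteq> d\<close> unfolding ab(3,4) by blast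
  qed
  then show ?thesis using union by (metis dvd_triv_left)
qed

text \<open>
  A nontrivial subgroup that stabilises a set of prime cardinality has that cardinality itself, so
  the set is a single left coset.
\<close>
lemma (in group) stable_prime_card_imp_coset:
  assumes K: "subgroup K G" and L: "L \<subseteq> carrier G" and p: "prime (card L)"
    and stable: "\<And>l k. l \<in> L \<Longrightarrow> k \<in> K \<Longrightarrow> l \<otimes> k \<in> L"
    and nontriv: "k \<in> K" "k \<noteq> \<one>"
    and ab: "a \<in> L" "b \<in> L"
  shows "inv a \<otimes> b \<in> K"
proof -
  interpret K: subgroup K G by fact
  have fin: "finite L" using p by (metis card.infinite not_prime_0)
  have "card K dvd card L"
    by (rule card_subgroup_dvd_card_stable_set[OF K L fin stable])
  moreover have a: "a \<in> carrier G" using ab L by auto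
  have inj: "inj_on (\<lambda>k. a \<otimes> k) K" using a by (auto intro!: inj_onI)
  have sub: "(\<lambda>k. a \<otimes> k) ` K \<subseteq> L" using stable ab by auto
  have "finite K" using inj sub fin by (metis finite_imageD finite_subset)
  then have "card K \<noteq> 1" using nontriv K.one_closed by (metis card_1_singletonE singletonD)
  ultimately have "card K = card L" using p by (auto simp: prime_nat_iff)
  then have "card ((\<lambda>k. a \<otimes> k) ` K) = card L" using inj by (simp add: card_image)
  then have "(\<lambda>k. a \<otimes> k) ` K = L" using sub fin by (simp add: card_subset_eq)
  then obtain k where "k \<in> K" "b = a \<otimes> k" using ab by auto
  then show ?thesis using a by (simp add: inv_cancel_left)
qed

section \<open>Twisting a group along a subgroup of index two\<close>

text \<open>
  The condition says that all elements outside \<open>E\<close> lie in one coset. The case \<open>E = G\<close> is included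
  so that parity arguments need no prior case distinction.
\<close>
locale index_le_two_subgroup = subgroup E G + group G for E and G (structure) +
  assumes mult_outside: "x \<in> carrier G \<Longrightarrow> y \<in> carrier G \<Longrightarrow> x \<notin> E \<Longrightarrow> y \<notin> E \<Longrightarrow> x \<otimes> y \<in> E"
begin

lemma inv_mem_iff: "x \<in> carrier G \<Longrightarrow> inv x \<in> E \<longleftrightarrow> x \<in> E"
  by (metis inv_inv m_inv_closed)

lemma mult_mem_iff:
  assumes "x \<in> carrier G" "y \<in> carrier G"
  shows "x \<otimes> y \<in> E \<longleftrightarrow> (x \<in> E \<longleftrightarrow> y \<in> E)"
proof -
  have "y \<in> E" if "x \<in> E" "x \<otimes> y \<in> E"
    using subgroup.m_closed[OF subgroup_axioms m_inv_closed[OF that(1)] that(2)] assms by (simp add: inv_cancel_left)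
  moreover have "x \<in> E" if "y \<in> E" "x \<otimes> y \<in> E"
    using subgroup.m_closed[OF subgroup_axioms that(2) m_inv_closed[OF that(1)]] assms by (simp add: m_assoc)
  ultimately show ?thesis using mult_outside assms by blast
qed

text \<open>
  Here \<open>g\<close> acts on \<open>y\<close> as left multiplication if \<open>g \<in> E\<close>, and as conjugation by \<open>r\<close> followed by
  left multiplication otherwise. When \<open>r\<^sup>2\<close> is central, conjugation by \<open>r\<close> has order at most two, so it
  can be attached to the nontrivial coset of \<open>E\<close>. The maps of the form \<open>y \<mapsto> h y r\<close> with
  \<open>h r \<notin> E\<close> thereby become left translations of a group.
\<close>
definition twisted_group :: "'a \<Rightarrow> 'a monoid" where
  "twisted_group r = \<lparr>carrier = carrier G,
     monoid.mult = (\<lambda>x y. if x \<in> E then x \<otimes> y else x \<otimes> (inv r \<otimes> y \<otimes> r)), one = \<one>\<rparr>"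

lemma group_twisted_group:
  assumes r: "r \<in> carrier G"
    and central: "\<And>x. x \<in> carrier G \<Longrightarrow> r \<otimes> r \<otimes> x = x \<otimes> (r \<otimes> r)"
  shows "group (twisted_group r)"
proof (rule groupI)
  fix x y z
  assume "x \<in> carrier (twisted_group r)" "y \<in> carrier (twisted_group r)"
    "z \<in> carrier (twisted_group r)"
  then have xyz: "x \<in> carrier G" "y \<in> carrier G" "z \<in> carrier G"
    by (simp_all add: twisted_group_def)
  have twice: "inv r \<otimes> (z \<otimes> (r \<otimes> r)) = r \<otimes> z"
    using xyz r central[of z, symmetric] by (simp add: m_assoc inv_cancel_left)
  show "(x \<otimes>\<^bsub>twisted_group r\<^esub> y) \<otimes>\<^bsub>twisted_group r\<^esub> z =
      x \<otimes>\<^bsub>twisted_group r\<^esub> (y \<otimes>\<^bsub>twisted_group r\<^esub> z)"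
    using xyz r
    by (auto simp: twisted_group_def mult_mem_iff inv_mem_iff m_assoc inv_cancel_left twice)
next
  fix x assume "x \<in> carrier (twisted_group r)"
  then have x: "x \<in> carrier G" by (simp add: twisted_group_def)
  have "inv r \<otimes> inv r \<otimes> (x \<otimes> (r \<otimes> r)) = x"
    using x r central[of x, symmetric] by (simp add: m_assoc inv_cancel_left)
  then have inverse: "inv r \<otimes> (inv r \<otimes> (x \<otimes> r)) = x \<otimes> inv r"
    using x r by (simp add: inv_solve_right m_assoc)
  show "\<exists>y\<in>carrier (twisted_group r). y \<otimes>\<^bsub>twisted_group r\<^esub> x = \<one>\<^bsub>twisted_group r\<^esub>"
    using x r
    by (intro bexI[of _ "if x \<in> E then inv x else r \<otimes> inv x \<otimes> inv r"])
      (auto simp: twisted_group_def mult_mem_iff inv_mem_iff m_assoc inverse inv_cancel_left)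
qed (use r in \<open>auto simp: twisted_group_def\<close>)

end

section \<open>Recognising Cayley graphs\<close>

text \<open>
  In the definition of a Cayley graph the connection set determines the predecessors of a vertex;
  symmetry allows \<open>T\<close> to describe the successors instead. Symmetry and looplessness of
  the graph also yield \<open>T = T\<^sup>-\<^sup>1\<close> and \<open>\<one> \<notin> T\<close>.
\<close>
lemma is_cayley_graphI:
  fixes H :: "('a, 'b) monoid_scheme"
  assumes H: "group H" and T: "T \<subseteq> carrier H"
    and verts: "pverts \<Gamma> = carrier H"
    and arcs: "\<And>x y. (x, y) \<in> parcs \<Gamma> \<longleftrightarrow> x \<in> carrier H \<and> (\<exists>t\<in>T. y = t \<otimes>\<^bsub>H\<^esub> x)"
    and sym: "sym (parcs \<Gamma>)" and irrefl: "irrefl (parcs \<Gamma>)"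
  shows "is_cayley_graph \<Gamma>"
proof -
  \<comment> \<open>The group of a Cayley graph is a plain record, so further fields of \<open>H\<close> have to be dropped.\<close>
  define K where "K = \<lparr>carrier = carrier H, monoid.mult = (\<otimes>\<^bsub>H\<^esub>), one = \<one>\<^bsub>H\<^esub>\<rparr>"
  interpret H: group H by fact
  have K_simps: "carrier K = carrier H" "x \<otimes>\<^bsub>K\<^esub> y = x \<otimes>\<^bsub>H\<^esub> y" "\<one>\<^bsub>K\<^esub> = \<one>\<^bsub>H\<^esub>" for x y
    by (simp_all add: K_def)
  interpret K: group K
    by (rule groupI) (auto simp: K_simps H.m_assoc intro: H.l_inv_ex)
  have K_T: "T \<subseteq> carrier K" using T by (simp add: K_simps)
  have arc_iff: "(x, y) \<in> parcs \<Gamma> \<longleftrightarrow> x \<in> carrier K \<and> y \<in> carrier K \<and> x \<otimes>\<^bsub>K\<^esub> inv\<^bsub>K\<^esub> y \<in> T"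
    for x y
  proof -
    have "(x, y) \<in> parcs \<Gamma> \<longleftrightarrow> (y, x) \<in> parcs \<Gamma>" using sym by (auto dest: symD)
    also have "\<dots> \<longleftrightarrow> y \<in> carrier K \<and> (\<exists>t\<in>T. x = t \<otimes>\<^bsub>K\<^esub> y)" using arcs by (simp add: K_simps)
    also have "\<dots> \<longleftrightarrow> x \<in> carrier K \<and> y \<in> carrier K \<and> x \<otimes>\<^bsub>K\<^esub> inv\<^bsub>K\<^esub> y \<in> T"
    proof (cases "x \<in> carrier K \<and> y \<in> carrier K")
      case True
      then have "x = t \<otimes>\<^bsub>K\<^esub> y \<longleftrightarrow> x \<otimes>\<^bsub>K\<^esub> inv\<^bsub>K\<^esub> y = t" if "t \<in> T" for t
        using that K_T K.inv_solve_right'[of t x y] by auto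
      then show ?thesis using True by auto
    next
      case False
      then show ?thesis using K_T K.m_closed by blast
    qed
    finally show ?thesis .
  qed
  have one: "\<one>\<^bsub>K\<^esub> \<notin> T"
    using arc_iff[of "\<one>\<^bsub>K\<^esub>" "\<one>\<^bsub>K\<^esub>"] irrefl by (auto simp: irrefl_def)
  have "inv\<^bsub>K\<^esub> t \<in> T" if "t \<in> T" for t
  proof -
    have t: "t \<in> carrier K" using that K_T by auto
    have "(t, \<one>\<^bsub>K\<^esub>) \<in> parcs \<Gamma>" using t that arc_iff by simp
    then have "(\<one>\<^bsub>K\<^esub>, t) \<in> parcs \<Gamma>" using sym by (auto dest: symD)
    then show ?thesis using t arc_iff by simp
  qed
  then have "set_inv\<^bsub>K\<^esub> T = T"
    unfolding SET_INV_def using K_T by auto (metis K.inv_inv subsetD)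
  moreover have "\<Gamma> = cayley_graph K T"
    using verts arc_iff by (auto simp: K_simps cayley_graph_def intro: pair_pre_digraph.equality)
  moreover have "digraph_iso (with_proj \<Gamma>) (with_proj \<Gamma>)"
  proof -
    have wf: "wf_digraph (with_proj \<Gamma>)"
      by unfold_locales (use verts arc_iff in \<open>auto simp: K_simps\<close>)
    show ?thesis
      unfolding digraph_iso_def
      by (rule exI[of _ "\<lparr>iso_verts = id, iso_arcs = id, iso_head = snd, iso_tail = fst\<rparr>"])
        (use wf in \<open>auto simp: pre_digraph.digraph_isomorphism_def app_iso_def with_proj_def\<close>)
  qed
  ultimately show ?thesis
    unfolding is_cayley_graph_def using K.group_axioms K_T one by metis
qed

lemma is_cayley_graph_digraph_iso:
  fixes \<Gamma> \<Delta> :: "'a pair_pre_digraph"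
  assumes "digraph_iso (with_proj \<Gamma>) (with_proj \<Delta>)" "is_cayley_graph \<Delta>"
  shows "is_cayley_graph \<Gamma>"
  using assms unfolding is_cayley_graph_def by (meson digraph_iso_trans)

lemma connected_digraph_iso:
  assumes "digraph_iso \<Gamma> \<Delta>" "connected \<Gamma>"
  shows "connected \<Delta>"
proof -
  from assms(1) obtain f where f: "pre_digraph.digraph_isomorphism \<Gamma> f" "\<Delta> = app_iso f \<Gamma>"
    unfolding digraph_iso_def by blast
  then interpret wf_digraph \<Gamma> by (simp add: pre_digraph.digraph_isomorphism_def)
  show ?thesis using connectedI_app_iso[OF assms(2) f(1)] f(2) by simp
qed

section \<open>Two-sided Cayley graphs\<close>

lemma parcs_twosided_cayley:
  assumes "group G" "L \<subseteq> carrier G" "R \<subseteq> carrier G"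
  shows "(x, y) \<in> parcs (twosided_cayley G L R) \<longleftrightarrow>
    x \<in> carrier G \<and> (\<exists>l\<in>L. \<exists>r\<in>R. y = inv\<^bsub>G\<^esub> l \<otimes>\<^bsub>G\<^esub> x \<otimes>\<^bsub>G\<^esub> r)"
proof -
  interpret group G by fact
  show ?thesis using assms(2,3) by (auto simp: twosided_cayley_def)
qed

lemma pverts_twosided_cayley: "pverts (twosided_cayley G L R) = carrier G"
  by (simp add: twosided_cayley_def)

text \<open>
  The reason is that \<open>(l\<^sup>-\<^sup>1 x r)\<^sup>-\<^sup>1 = r\<^sup>-\<^sup>1 x\<^sup>-\<^sup>1 l\<close>.
\<close>
lemma parcs_twosided_cayley_swap:
  fixes G (structure)
  assumes "group G" "L \<subseteq> carrier G" "R \<subseteq> carrier G"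
  shows "parcs (twosided_cayley G R L) = map_prod (m_inv G) (m_inv G) ` parcs (twosided_cayley G L R)"
proof -
  interpret group G by fact
  have arcs: "map_prod (m_inv G) (m_inv G) ` parcs (twosided_cayley G L R) \<subseteq> parcs (twosided_cayley G R L)"
    if "L \<subseteq> carrier G" "R \<subseteq> carrier G" for L R
  proof (clarsimp simp: parcs_twosided_cayley[OF group_axioms] that)
    fix x l r assume "x \<in> carrier G" "l \<in> L" "r \<in> R"
    moreover from this that have "l \<in> carrier G" "r \<in> carrier G" by auto
    ultimately show "\<exists>m\<in>R. \<exists>s\<in>L. inv (inv l \<otimes> x \<otimes> r) = inv m \<otimes> inv x \<otimes> s"
      by (intro bexI[of _ r] bexI[of _ l]) (simp_all add: inv_mult_group m_assoc)
  qed
  have "parcs (twosided_cayley G R L) \<subseteq> map_prod (m_inv G) (m_inv G) ` parcs (twosided_cayley G L R)"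
  proof
    fix e assume e: "e \<in> parcs (twosided_cayley G R L)"
    then have "map_prod (m_inv G) (m_inv G) e \<in> parcs (twosided_cayley G L R)"
      using arcs[OF assms(3,2)] by blast
    moreover have "e = map_prod (m_inv G) (m_inv G) (map_prod (m_inv G) (m_inv G) e)"
      using e by (cases e) (auto simp: twosided_cayley_def)
    ultimately show "e \<in> map_prod (m_inv G) (m_inv G) ` parcs (twosided_cayley G L R)" by blast
  qed
  then show ?thesis using arcs[OF assms(2,3)] by blast
qed

lemma digraph_iso_twosided_cayley_swap:
  fixes G (structure)
  assumes "group G" "L \<subseteq> carrier G" "R \<subseteq> carrier G"
  shows "digraph_iso (with_proj (twosided_cayley G L R)) (with_proj (twosided_cayley G R L))"
proof -
  interpret group G by fact
  let ?f = "\<lparr>iso_verts = m_inv G, iso_arcs = map_prod (m_inv G) (m_inv G),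
    iso_head = snd, iso_tail = fst\<rparr>"
  have verts_eq: "m_inv G ` carrier G = carrier G"
    by (auto simp: image_iff) (metis inv_closed inv_inv)
  have inj: "inj_on (m_inv G) (carrier G)"
    by (rule inj_onI) (metis inv_inv)
  have sub: "parcs (twosided_cayley G L R) \<subseteq> carrier G \<times> carrier G"
    by (auto simp: twosided_cayley_def)
  have wf: "wf_digraph (with_proj (twosided_cayley G L R))"
    by unfold_locales (auto simp: twosided_cayley_def)
  have "pre_digraph.digraph_isomorphism (with_proj (twosided_cayley G L R)) ?f"
    unfolding pre_digraph.digraph_isomorphism_def using wf inj
    by (auto simp: pverts_twosided_cayley map_prod_def
        intro!: inj_on_subset[OF map_prod_inj_on[OF inj inj, unfolded map_prod_def] sub])
  moreover have "with_proj (twosided_cayley G R L) = app_iso ?f (with_proj (twosided_cayley G L R))"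
    by (simp add: app_iso_def with_proj_def pverts_twosided_cayley parcs_twosided_cayley_swap[OF assms] verts_eq)
  ultimately show ?thesis unfolding digraph_iso_def by blast
qed

text \<open>
  If \<open>y = l\<^sup>-\<^sup>1 x r\<close>, the first defining condition rewrites \<open>y\<close> as \<open>l' x r'\<^sup>-\<^sup>1\<close>, and solving for \<open>x\<close>
  gives the reverse arc.
\<close>
lemma sym_twosided_cayley:
  fixes G (structure)
  assumes "group G" and property: "twosided_cayley_property G L R"
  shows "sym (parcs (twosided_cayley G L R))"
proof (rule symI)
  interpret group G by fact
  have LR: "L \<subseteq> carrier G" "R \<subseteq> carrier G"
    using property by (auto simp: twosided_cayley_property_def)
  note arc_iff = parcs_twosided_cayley[OF group_axioms LR]
  fix x y assume "(x, y) \<in> parcs (twosided_cayley G L R)"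
  then obtain l r where x: "x \<in> carrier G" and lr: "l \<in> L" "r \<in> R" "y = inv l \<otimes> x \<otimes> r"
    by (auto simp: arc_iff)
  then have "y \<in> set_inv L #> x <#> R"
    by (auto simp: SET_INV_def r_coset_def set_mult_def)
  then have "y \<in> L #> x <#> set_inv R"
    using property x by (auto simp: twosided_cayley_property_def)
  then obtain l' r' where lr': "l' \<in> L" "r' \<in> R" "y = l' \<otimes> x \<otimes> inv r'"
    by (auto simp: SET_INV_def r_coset_def set_mult_def)
  then have c: "l' \<in> carrier G" "r' \<in> carrier G" using LR by auto
  have "x = inv l' \<otimes> y \<otimes> r'"
    using x lr' c by (simp add: m_assoc inv_cancel_left)
  moreover have "y \<in> carrier G" using x lr' c by simp
  ultimately show "(y, x) \<in> parcs (twosided_cayley G L R)"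
    using lr' by (auto simp: arc_iff)
qed

text \<open>
  A loop \<open>x = l\<^sup>-\<^sup>1 x r\<close> makes \<open>r = x\<^sup>-\<^sup>1 l x\<close> a conjugate of \<open>l\<close>.
\<close>
lemma irrefl_twosided_cayley:
  fixes G (structure)
  assumes "group G" and property: "twosided_cayley_property G L R"
  shows "irrefl (parcs (twosided_cayley G L R))"
proof (rule irreflI)
  interpret group G by fact
  have LR: "L \<subseteq> carrier G" "R \<subseteq> carrier G"
    using property by (auto simp: twosided_cayley_property_def)
  fix x show "(x, x) \<notin> parcs (twosided_cayley G L R)"
  proof
    assume "(x, x) \<in> parcs (twosided_cayley G L R)"
    then obtain l r where x: "x \<in> carrier G" and lr: "l \<in> L" "r \<in> R" "x = inv l \<otimes> x \<otimes> r"
      by (auto simp: parcs_twosided_cayley[OF group_axioms LR])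
    then have c: "l \<in> carrier G" "r \<in> carrier G" using LR by auto
    have "l \<otimes> x = l \<otimes> (inv l \<otimes> x \<otimes> r)" using lr(3) by (rule arg_cong)
    then have "l \<otimes> x = x \<otimes> r" using x c by (simp add: m_assoc inv_cancel_left)
    then have "r = inv x \<otimes> l \<otimes> x" using x c by (simp add: m_assoc inv_cancel_left)
    then have "r \<in> conj_set G L x"
      using lr(1) by (auto simp: conj_set_def l_coset_def r_coset_def)
    then show False using property x lr(2) by (auto simp: twosided_cayley_property_def)
  qed
qed

text \<open>
  The successors \<open>l\<^sup>-\<^sup>1 r\<close> of the identity are pairwise distinct: if \<open>l\<^sup>-\<^sup>1 r = l'\<^sup>-\<^sup>1 r'\<close>, then
  \<open>l' l\<^sup>-\<^sup>1 = r' r\<^sup>-\<^sup>1\<close> lies in \<open>L L\<^sup>-\<^sup>1 \<inter> R R\<^sup>-\<^sup>1\<close> and is trivial by the third defining condition.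
\<close>
lemma card_mult_card_eq_valency:
  fixes G (structure)
  assumes "group G" and property: "twosided_cayley_property G L R"
    and valency: "regular_of_valency (twosided_cayley G L R) k"
  shows "card L * card R = k"
proof -
  interpret group G by fact
  have LR: "L \<subseteq> carrier G" "R \<subseteq> carrier G"
    using property by (auto simp: twosided_cayley_property_def)
  let ?f = "\<lambda>(l, r). (\<one>, inv l \<otimes> r)"
  have "out_arcs (with_proj (twosided_cayley G L R)) \<one> = ?f ` (L \<times> R)"
  proof -
    have "out_arcs (with_proj (twosided_cayley G L R)) \<one> =
        (\<lambda>(l, r). (\<one>, inv l \<otimes> \<one> \<otimes> r)) ` (L \<times> R)"
      by (force simp: out_arcs_def parcs_twosided_cayley[OF group_axioms LR])
    also have "\<dots> = ?f ` (L \<times> R)"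
      using LR by (intro image_cong) (auto simp: subset_iff)
    finally show ?thesis .
  qed
  moreover have "inj_on ?f (L \<times> R)"
  proof (rule inj_onI, clarify)
    fix l r l' r' assume m: "l \<in> L" "r \<in> R" "l' \<in> L" "r' \<in> R" and eq: "inv l \<otimes> r = inv l' \<otimes> r'"
    then have c: "l \<in> carrier G" "r \<in> carrier G" "l' \<in> carrier G" "r' \<in> carrier G"
      using LR by auto
    have "l' \<otimes> (inv l \<otimes> r) \<otimes> inv r = l' \<otimes> (inv l' \<otimes> r') \<otimes> inv r" using eq by simp
    then have quot: "l' \<otimes> inv l = r' \<otimes> inv r" using c by (simp add: m_assoc inv_cancel_left)
    have "inv \<one> \<otimes> (l' \<otimes> inv l) \<otimes> \<one> \<in> conj_set G (L <#> set_inv L) \<one>"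
      using m by (auto simp: conj_set_def l_coset_def r_coset_def set_mult_def SET_INV_def)
    moreover have "inv \<one> \<otimes> (l' \<otimes> inv l) \<otimes> \<one> = r' \<otimes> inv r" using c quot by simp
    moreover have "r' \<otimes> inv r \<in> R <#> set_inv R"
      using m by (auto simp: set_mult_def SET_INV_def)
    moreover have "conj_set G (L <#> set_inv L) \<one> \<inter> (R <#> set_inv R) = {\<one>}"
      using property by (simp add: twosided_cayley_property_def)
    ultimately have one: "r' \<otimes> inv r = \<one>" by auto
    have "r' = r' \<otimes> inv r \<otimes> r" "l' = l' \<otimes> inv l \<otimes> l" using c by (simp_all add: m_assoc)
    then show "l = l' \<and> r = r'" using one quot c by simp
  qed
  ultimately have "card (L \<times> R) = out_degree (with_proj (twosided_cayley G L R)) \<one>"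
    by (simp add: out_degree_def card_image)
  also have "\<dots> = k"
    using valency by (simp add: regular_of_valency_def pverts_twosided_cayley)
  finally show ?thesis by (simp add: card_cartesian_product)
qed

section \<open>Conjugacy in dihedral groups of twice-odd order\<close>

text \<open>
  For odd \<open>n\<close> no rotation other than the identity has a central square, so \<open>r\<close> is a reflection. The
  reflections form one conjugacy class, so \<open>L\<close> is contained in the rotation subgroup.
\<close>
lemma generate_proper_dihedral_group:
  fixes G (structure)
  assumes "group G" and n: "odd n" and iso: "G \<cong> dihedral_group n"
    and r: "r \<in> carrier G" "r \<notin> group_centre G" "r \<otimes> r \<in> group_centre G"
    and L: "L \<subseteq> carrier G" "L \<inter> conj_class G r = {}"
  shows "generate G L \<noteq> carrier G"
proof -
  interpret group G by fact
  have n_pos: "n > 0" using n by (rule odd_pos)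
  interpret D: group "dihedral_group n" by (rule group_dihedral_group[OF n_pos])
  obtain h where h: "h \<in> iso G (dihedral_group n)" using iso by (auto simp: is_iso_def)
  then have hom: "h \<in> hom G (dihedral_group n)"
    and bij: "bij_betw h (carrier G) (carrier (dihedral_group n))"
    by (auto simp: iso_def)
  interpret h: group_hom G "dihedral_group n" h
    by unfold_locales (rule hom)
  note h.hom_mult [simp del] h.hom_inv [simp del] h.hom_one [simp del]
  have h_mult: "h (x \<otimes> y) = ((if snd (h x) then fst (h x) - fst (h y) else fst (h x) + fst (h y)) mod int n,
      snd (h x) \<noteq> snd (h y))" if "x \<in> carrier G" "y \<in> carrier G" for x y
    using h.hom_mult[OF that] by (cases "h x"; cases "h y") (simp add: dihedral_group_def)
  have h_range: "0 \<le> fst (h x)" "fst (h x) < int n" if "x \<in> carrier G" for x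
    using h.hom_closed[OF that] by (auto simp: dihedral_group_def)
  have h_inj: "x = y" if "h x = h y" "x \<in> carrier G" "y \<in> carrier G" for x y
    using bij that by (auto simp: bij_betw_def dest: inj_onD)
  have h_surj: "\<exists>x\<in>carrier G. h x = (i, s)" if "0 \<le> i" "i < int n" for i s
  proof -
    have "(i, s) \<in> carrier (dihedral_group n)" using that by (simp add: dihedral_group_def)
    then have "(i, s) \<in> h ` carrier G" using bij by (simp add: bij_betw_def)
    then show ?thesis by (metis imageE)
  qed
  have h_one: "h \<one> = (0, False)" using h.hom_one by (simp add: dihedral_group_def)
  have h_inv: "snd (h (inv x)) = snd (h x)" if "x \<in> carrier G" for x
    using h_mult[of x "inv x"] that h_one by simp
  define A where "A = {x \<in> carrier G. \<not> snd (h x)}"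
  have A: "subgroup A G"
  proof (rule subgroupI)
    have "\<one> \<in> A" by (simp add: A_def h_one)
    then show "A \<noteq> {}" by blast
  qed (auto simp: A_def h_mult h_inv)
  have reflection: "snd (h r)"
  proof (rule ccontr)
    assume rot: "\<not> snd (h r)"
    obtain y where y: "y \<in> carrier G" "h y = (0, True)"
      using h_surj[of 0 True] n_pos by auto
    \<comment> \<open>A reflection inverts the rotation \<open>r\<^sup>2\<close>, which is central, so \<open>r\<^sup>4\<close> is trivial.\<close>
    have "h (r \<otimes> r \<otimes> y) = h (y \<otimes> (r \<otimes> r))"
      using r y by (simp add: group_centre_def)
    then have "(fst (h r) + fst (h r)) mod int n = (- (fst (h r) + fst (h r))) mod int n"
      using r y rot by (simp add: h_mult mod_simps)
    then have "int n dvd 4 * fst (h r)"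
      by (simp add: mod_eq_dvd_iff algebra_simps)
    moreover have "coprime (int n) (2 ^ 2)"
      using n by (subst coprime_power_right_iff) auto
    ultimately have "int n dvd fst (h r)"
      by (simp add: coprime_dvd_mult_right_iff)
    then have "fst (h r) = 0"
      using h_range[OF r(1)] by (metis zdvd_not_zless order_le_less)
    then have "h r = h \<one>" using rot h_one by (simp add: prod_eq_iff)
    then have "r = \<one>" using h_inj r by simp
    then show False using r by (simp add: group_centre_def)
  qed
  have "l \<in> A" if l: "l \<in> L" for l
  proof (rule ccontr)
    assume "l \<notin> A"
    then have lc: "l \<in> carrier G" "snd (h l)" using l L by (auto simp: A_def)
    \<comment> \<open>Conjugating by the rotation with index \<open>k\<close> shifts the index of a reflection by \<open>2 k\<close>;
      since \<open>n\<close> is odd, \<open>m = (n + 1) / 2\<close> is the inverse of \<open>2\<close> modulo \<open>n\<close>.\<close>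
    obtain m where m: "n + 1 = 2 * m" using n by (metis even_Suc evenE Suc_eq_plus1)
    let ?d = "fst (h r) - fst (h l)"
    have "\<exists>g\<in>carrier G. h g = (?d * int m mod int n, False)"
      using n_pos by (intro h_surj) auto
    then obtain g where g: "g \<in> carrier G" "h g = (?d * int m mod int n, False)" by blast
    have "int n + 1 = 2 * int m" using m by linarith
    then have "?d * (int n + 1) = 2 * (?d * int m)" by simp
    then have "fst (h r) - ?d * int m - (?d * int m + fst (h l)) = - ?d * int n"
      by (simp add: algebra_simps)
    then have "(fst (h r) - ?d * int m) mod int n = (?d * int m + fst (h l)) mod int n"
      by (metis dvd_triv_right mod_eq_dvd_iff)
    then have "h (r \<otimes> g) = h (g \<otimes> l)"
      using r lc g reflection by (simp add: h_mult mod_simps)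
    then have "r \<otimes> g = g \<otimes> l" using h_inj r lc g by simp
    then have "l = inv g \<otimes> r \<otimes> g" using r lc g by (simp add: m_assoc inv_cancel_left)
    then show False using L l g by (auto simp: conj_class_def)
  qed
  then have "generate G L \<subseteq> A" by (intro generate_subgroup_incl[OF _ A]) auto
  moreover have "r \<notin> A" using reflection by (simp add: A_def)
  ultimately show ?thesis using r by auto
qed

section \<open>Two-sided Cayley graphs with a singleton side\<close>

text \<open>
  The graph conditions are hypotheses in place of the defining conditions on \<open>(L, {r})\<close> because,
  unlike those, they visibly survive the isomorphism that interchanges the two sides.
\<close>
locale singleton_twosided_cayley = group G for G (structure) +
  fixes L r
  assumes L_carrier: "L \<subseteq> carrier G" and r_carrier [simp]: "r \<in> carrier G"
    and prime_card: "prime (card L)"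
    and sym_arcs: "sym (parcs (twosided_cayley G L {r}))"
    and irrefl_arcs: "irrefl (parcs (twosided_cayley G L {r}))"
    and connected_graph: "connected (with_proj (twosided_cayley G L {r}))"
begin

lemma L_mem_carrier [simp]: "l \<in> L \<Longrightarrow> l \<in> carrier G"
  using L_carrier by auto

lemma finite_L: "finite L"
  using prime_card by (metis card.infinite not_prime_0)

lemma L_nonempty: "\<exists>l. l \<in> L"
  using prime_card by (metis card.empty equals0I not_prime_0)

lemma arc_iff:
  "(x, y) \<in> parcs (twosided_cayley G L {r}) \<longleftrightarrow> x \<in> carrier G \<and> (\<exists>l\<in>L. y = inv l \<otimes> x \<otimes> r)"
  by (simp add: parcs_twosided_cayley[OF group_axioms] L_carrier)

lemma no_fixed_point:
  assumes "x \<in> carrier G" "l \<in> L"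
  shows "inv l \<otimes> x \<otimes> r \<noteq> x"
  using assms irrefl_arcs arc_iff by (metis irreflD)

text \<open>
  Connectedness as an induction principle: since the graph is symmetric, every vertex is
  reached from the identity by steps in the forward direction.
\<close>
lemma step_induct [consumes 1, case_names one step]:
  assumes x: "x \<in> carrier G" and one: "P \<one>"
    and step: "\<And>x l. x \<in> carrier G \<Longrightarrow> P x \<Longrightarrow> l \<in> L \<Longrightarrow> P (inv l \<otimes> x \<otimes> r)"
  shows "P x"
proof -
  have "(\<one>, x) \<in> rtrancl_on (carrier G) ((parcs (twosided_cayley G L {r}))\<^sup>s)"
    using connected_graph x by (simp add: connected_conv pverts_twosided_cayley)
  then show ?thesis
  proof (induction rule: rtrancl_on_induct)
    case (step y z)
    then have "(y, z) \<in> parcs (twosided_cayley G L {r})"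
      using sym_arcs by (auto simp: symcl_def dest: symD)
    then show ?case using step assms(3) by (auto simp: arc_iff)
  qed (use one in auto)
qed

text \<open>
  The step from \<open>g\<close> to \<open>l\<^sup>-\<^sup>1 g r\<close> is undone by some \<open>m \<in> L\<close>, that is \<open>g = m\<^sup>-\<^sup>1 (l\<^sup>-\<^sup>1 g r) r\<close>, and
  solving for \<open>m\<close> gives the element in question. In this form symmetry enters all arguments below.
\<close>
lemma inv_mult_conj_square:
  assumes l: "l \<in> L" and g: "g \<in> carrier G"
  shows "inv l \<otimes> (g \<otimes> (r \<otimes> r) \<otimes> inv g) \<in> L"
proof -
  have "(g, inv l \<otimes> g \<otimes> r) \<in> parcs (twosided_cayley G L {r})"
    using l g by (auto simp: arc_iff)
  then have "(inv l \<otimes> g \<otimes> r, g) \<in> parcs (twosided_cayley G L {r})"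
    using sym_arcs by (auto dest: symD)
  then obtain m where m: "m \<in> L" "g = inv m \<otimes> (inv l \<otimes> g \<otimes> r) \<otimes> r"
    by (auto simp: arc_iff)
  have "m \<otimes> g = m \<otimes> (inv m \<otimes> (inv l \<otimes> g \<otimes> r) \<otimes> r)"
    using m(2) by (rule arg_cong)
  also have "\<dots> = inv l \<otimes> g \<otimes> r \<otimes> r"
    using l g m(1) by (simp add: m_assoc inv_cancel_left)
  finally have "m = inv l \<otimes> g \<otimes> r \<otimes> r \<otimes> inv g"
    using l g m(1) by (simp add: inv_solve_right)
  then show ?thesis using l g m(1) by (simp add: m_assoc)
qed

lemma inv_mult_square: "l \<in> L \<Longrightarrow> inv l \<otimes> (r \<otimes> r) \<in> L"
  using inv_mult_conj_square[of l \<one>] by simp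

text \<open>
  As \<open>L = L\<^sup>-\<^sup>1 r\<^sup>2\<close>, two consecutive steps take the identity to \<open>l\<^sup>-\<^sup>1 m\<^sup>-\<^sup>1 r\<^sup>2 \<in> L\<^sup>-\<^sup>1 L\<close>; the subgroup
  consists of the vertices at the ends of walks of even length from the identity.
\<close>
definition even_part where
  "even_part = generate G {inv l \<otimes> m | l m. l \<in> L \<and> m \<in> L}"

lemma subgroup_even_part: "subgroup even_part G"
  unfolding even_part_def by (rule generate_is_subgroup) auto

sublocale even: subgroup even_part G
  by (rule subgroup_even_part)

lemma inv_mult_even: "l \<in> L \<Longrightarrow> m \<in> L \<Longrightarrow> inv l \<otimes> m \<in> even_part"
  unfolding even_part_def by (auto intro: generate.incl)

lemma inv_inv_square_even:
  assumes "l \<in> L" "m \<in> L"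
  shows "inv l \<otimes> (inv m \<otimes> (r \<otimes> r)) \<in> even_part"
  using inv_mult_even inv_mult_square assms by blast

text \<open>
  A generator \<open>a\<^sup>-\<^sup>1 b\<close> becomes \<open>(l\<^sup>-\<^sup>1 a\<^sup>-\<^sup>1 r\<^sup>2) (l\<^sup>-\<^sup>1 b\<^sup>-\<^sup>1 r\<^sup>2)\<^sup>-\<^sup>1\<close>, a product of elements of the subgroup.
\<close>
lemma conj_even:
  assumes l: "l \<in> L" and x: "x \<in> even_part"
  shows "inv l \<otimes> x \<otimes> l \<in> even_part"
proof -
  have gen: "inv l \<otimes> (inv a \<otimes> b) \<otimes> l \<in> even_part" if "a \<in> L" "b \<in> L" for a b
  proof -
    have "inv l \<otimes> (inv a \<otimes> (r \<otimes> r)) \<otimes> inv (inv l \<otimes> (inv b \<otimes> (r \<otimes> r))) \<in> even_part"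
      using even.m_closed[OF inv_inv_square_even even.m_inv_closed[OF inv_inv_square_even]]
        that l by blast
    then show ?thesis using that l by (simp add: inv_mult_group m_assoc inv_cancel_left)
  qed
  from x show ?thesis unfolding even_part_def
  proof induction
    case one
    show ?case using l by (simp flip: even_part_def)
  next
    case (incl h)
    then show ?case using gen unfolding even_part_def by auto
  next
    case (inv h)
    then obtain a b where ab: "a \<in> L" "b \<in> L" "h = inv a \<otimes> b" by auto
    then have "inv h = inv b \<otimes> a" by (simp add: inv_mult_group)
    then show ?case using gen[of b a] ab unfolding even_part_def by simp
  next
    case (eng h1 h2)
    then have h: "h1 \<in> even_part" "h2 \<in> even_part" unfolding even_part_def by auto
    then have c: "h1 \<in> carrier G" "h2 \<in> carrier G" by auto
    have "inv l \<otimes> h1 \<otimes> l \<otimes> (inv l \<otimes> h2 \<otimes> l) \<in> even_part"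
      using eng by (simp flip: even_part_def)
    then show ?case using l c by (simp add: m_assoc inv_cancel_left even_part_def)
  qed
qed

text \<open>
  A step exchanges the two cosets \<open>E\<close> and \<open>E l\<^sup>-\<^sup>1 r\<close> of \<open>E = even_part\<close>, so by connectedness they
  cover the group. In terms of \<open>e = x r\<^sup>-\<^sup>1 l\<close>, a step from the second coset is
  \<open>m\<^sup>-\<^sup>1 x r = (m\<^sup>-\<^sup>1 e m) (m\<^sup>-\<^sup>1 l\<^sup>-\<^sup>1 r\<^sup>2)\<close>.
\<close>
lemma even_or_shifted_even:
  assumes x: "x \<in> carrier G" and l: "l \<in> L"
  shows "x \<in> even_part \<or> x \<otimes> inv r \<otimes> l \<in> even_part"
  using x
proof (induction rule: step_induct)
  case one
  then show ?case by simp
next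
  case (step x m)
  show ?case
  proof (cases "x \<in> even_part")
    case True
    then have "inv m \<otimes> x \<otimes> m \<otimes> (inv m \<otimes> l) \<in> even_part"
      using even.m_closed[OF conj_even inv_mult_even] True step l by blast
    then show ?thesis using step l by (simp add: m_assoc inv_cancel_left)
  next
    case False
    then have "x \<otimes> inv r \<otimes> l \<in> even_part" using step by simp
    then have "inv m \<otimes> (x \<otimes> inv r \<otimes> l) \<otimes> m \<otimes> (inv m \<otimes> (inv l \<otimes> (r \<otimes> r))) \<in> even_part"
      using even.m_closed[OF conj_even inv_inv_square_even] step l by blast
    then show ?thesis using step l by (simp add: m_assoc inv_cancel_left)
  qed
qed

lemma index_le_two_subgroup_even_part: "index_le_two_subgroup even_part G"
proof unfold_locales
  fix x y assume xy: "x \<in> carrier G" "y \<in> carrier G" "x \<notin> even_part" "y \<notin> even_part"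
  obtain l where l: "l \<in> L" using L_nonempty by blast
  have "inv y \<notin> even_part" using xy by (metis even.m_inv_closed inv_inv)
  then have "inv y \<otimes> inv r \<otimes> l \<in> even_part" "x \<otimes> inv r \<otimes> l \<in> even_part"
    using even_or_shifted_even[OF _ l] xy by blast+
  then have "x \<otimes> inv r \<otimes> l \<otimes> inv (inv y \<otimes> inv r \<otimes> l) \<in> even_part" by simp
  then show "x \<otimes> y \<in> even_part" using xy l by (simp add: inv_mult_group m_assoc inv_cancel_left)
qed

sublocale even: index_le_two_subgroup even_part G
  by (rule index_le_two_subgroup_even_part)

lemma step_odd:
  assumes proper: "even_part \<noteq> carrier G" and l: "l \<in> L"
  shows "inv l \<otimes> r \<notin> even_part"
proof
  assume e: "inv l \<otimes> r \<in> even_part"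
  have "x \<in> even_part" if x: "x \<in> carrier G" for x
    using even_or_shifted_even[OF x l]
  proof
    assume "x \<otimes> inv r \<otimes> l \<in> even_part"
    then have "x \<otimes> inv r \<otimes> l \<otimes> (inv l \<otimes> r) \<in> even_part" using e by blast
    then show ?thesis using x l by (simp add: m_assoc inv_cancel_left)
  qed
  then show False using proper even.subset by blast
qed

lemma is_cayley_graph_central:
  assumes central: "r \<in> group_centre G"
  shows "is_cayley_graph (twosided_cayley G L {r})"
proof (rule is_cayley_graphI[of G "{inv l \<otimes> r | l. l \<in> L}"])
  fix x y
  have "inv l \<otimes> x \<otimes> r = inv l \<otimes> r \<otimes> x" if "l \<in> L" "x \<in> carrier G" for l
    using that central by (auto simp: group_centre_def m_assoc)
  then show "(x, y) \<in> parcs (twosided_cayley G L {r}) \<longleftrightarrow>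
      x \<in> carrier G \<and> (\<exists>t\<in>{inv l \<otimes> r | l. l \<in> L}. y = t \<otimes> x)"
    by (auto simp: arc_iff)
qed (use sym_arcs irrefl_arcs in \<open>auto simp: group_axioms pverts_twosided_cayley\<close>)

text \<open>
  Steps change parity, so each of them is left translation by \<open>l\<^sup>-\<^sup>1 r\<close> in the group that is twisted by
  conjugation with \<open>r\<close>.
\<close>
lemma is_cayley_graph_square_central:
  assumes proper: "even_part \<noteq> carrier G"
    and central: "r \<otimes> r \<in> group_centre G"
  shows "is_cayley_graph (twosided_cayley G L {r})"
proof (rule is_cayley_graphI[of "even.twisted_group r" "{inv l \<otimes> r | l. l \<in> L}"])
  show "group (even.twisted_group r)"
    using central by (intro even.group_twisted_group) (auto simp: group_centre_def)
  fix x y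
  have "inv l \<otimes> x \<otimes> r = inv l \<otimes> r \<otimes>\<^bsub>even.twisted_group r\<^esub> x" if "l \<in> L" "x \<in> carrier G" for l
    using that step_odd[OF proper, of l]
    by (simp add: even.twisted_group_def m_assoc inv_cancel_left)
  then show "(x, y) \<in> parcs (twosided_cayley G L {r}) \<longleftrightarrow> x \<in> carrier (even.twisted_group r) \<and>
      (\<exists>t\<in>{inv l \<otimes> r | l. l \<in> L}. y = t \<otimes>\<^bsub>even.twisted_group r\<^esub> x)"
    by (auto simp: arc_iff even.twisted_group_def)
qed (use sym_arcs irrefl_arcs in \<open>auto simp: even.twisted_group_def pverts_twosided_cayley\<close>)

text \<open>
  For a conjugate \<open>w\<close> of \<open>r\<^sup>2\<close>, the injection \<open>m \<mapsto> m\<^sup>-\<^sup>1 w\<close> of the finite set \<open>L\<close> into itself is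
  surjective. Hence \<open>l = m\<^sup>-\<^sup>1 w\<close> for some \<open>m\<close>, and \<open>l w\<^sup>-\<^sup>1 w' = m\<^sup>-\<^sup>1 w' \<in> L\<close>.
\<close>
lemma mult_inv_conj_square:
  assumes l: "l \<in> L" and g: "g \<in> carrier G" and h: "h \<in> carrier G"
  shows "l \<otimes> (inv (g \<otimes> (r \<otimes> r) \<otimes> inv g) \<otimes> (h \<otimes> (r \<otimes> r) \<otimes> inv h)) \<in> L"
proof -
  let ?w = "g \<otimes> (r \<otimes> r) \<otimes> inv g"
  have w: "?w \<in> carrier G" using g by simp
  have "inj_on (\<lambda>m. inv m \<otimes> ?w) L"
    using w by (intro inj_onI) (metis L_mem_carrier inv_closed inv_inv right_cancel)
  moreover have "(\<lambda>m. inv m \<otimes> ?w) ` L \<subseteq> L" using inv_mult_conj_square g by auto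
  ultimately have "(\<lambda>m. inv m \<otimes> ?w) ` L = L" using finite_L by (simp add: endo_inj_surj)
  then obtain m where m: "m \<in> L" "l = inv m \<otimes> ?w" using l by auto
  have "l \<otimes> (inv ?w \<otimes> (h \<otimes> (r \<otimes> r) \<otimes> inv h)) = inv m \<otimes> (h \<otimes> (r \<otimes> r) \<otimes> inv h)"
    unfolding m(2) using m(1) w h by (simp add: m_assoc inv_cancel_left)
  then show ?thesis using inv_mult_conj_square[OF m(1) h] by simp
qed

text \<open>
  If \<open>r\<^sup>2\<close> is not central, it has two distinct conjugates, and their quotient is a nontrivial
  element of the right stabiliser of \<open>L\<close>. As \<open>|L|\<close> is prime, \<open>L\<close> is a coset of that stabiliser,
  which therefore contains all generators \<open>l\<^sup>-\<^sup>1 m\<close> of the even part.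
\<close>
lemma mult_even_stable:
  assumes noncentral: "r \<otimes> r \<notin> group_centre G"
    and l: "l \<in> L" and x: "x \<in> even_part"
  shows "l \<otimes> x \<in> L"
proof -
  define K where "K = {k \<in> carrier G. \<forall>l\<in>L. l \<otimes> k \<in> L}"
  have K: "subgroup K G"
  proof (rule subgroupI)
    show "K \<subseteq> carrier G" "K \<noteq> {}" by (auto simp: K_def intro: exI[of _ \<one>])
  next
    fix a assume a: "a \<in> K"
    then have c: "a \<in> carrier G" by (simp add: K_def)
    have "inj_on (\<lambda>l. l \<otimes> a) L" using c by (intro inj_onI) simp
    moreover have "(\<lambda>l. l \<otimes> a) ` L \<subseteq> L" using a by (auto simp: K_def)
    ultimately have surj: "(\<lambda>l. l \<otimes> a) ` L = L" using finite_L by (simp add: endo_inj_surj)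
    have "l \<otimes> inv a \<in> L" if "l \<in> L" for l
    proof -
      have "l \<in> (\<lambda>l. l \<otimes> a) ` L" using that surj by simp
      then obtain m where "m \<in> L" "l = m \<otimes> a" by auto
      then show ?thesis using c by (simp add: m_assoc)
    qed
    then show "inv a \<in> K" using c by (simp add: K_def)
  next
    fix a b assume "a \<in> K" "b \<in> K"
    then show "a \<otimes> b \<in> K" by (auto simp: K_def simp flip: m_assoc)
  qed
  from noncentral obtain g where g: "g \<in> carrier G" "r \<otimes> r \<otimes> g \<noteq> g \<otimes> (r \<otimes> r)"
    by (auto simp: group_centre_def)
  let ?k = "inv (g \<otimes> (r \<otimes> r) \<otimes> inv g) \<otimes> (\<one> \<otimes> (r \<otimes> r) \<otimes> inv \<one>)"
  have "?k \<in> K" unfolding K_def using g mult_inv_conj_square[of _ g \<one>] by simp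
  moreover have "?k \<noteq> \<one>"
  proof
    assume "?k = \<one>"
    then have "\<one> \<otimes> (r \<otimes> r) \<otimes> inv \<one> = g \<otimes> (r \<otimes> r) \<otimes> inv g"
      using g by (metis inv_closed inv_equality inv_inv m_closed one_closed r_carrier)
    then have "r \<otimes> r \<otimes> g = g \<otimes> (r \<otimes> r)" using g by (simp add: m_assoc)
    then show False using g by simp
  qed
  ultimately have "inv a \<otimes> b \<in> K" if "a \<in> L" "b \<in> L" for a b
    using stable_prime_card_imp_coset[OF K L_carrier prime_card _ _ _ that] by (auto simp: K_def)
  then have "even_part \<subseteq> K"
    unfolding even_part_def by (intro generate_subgroup_incl[OF _ K]) auto
  then show ?thesis using l x by (auto simp: K_def)
qed

text \<open>
  Here \<open>L\<close> is a coset of the even part, so every vertex is joined to all vertices of the other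
  parity: the graph is complete bipartite.
\<close>
lemma is_cayley_graph_square_noncentral:
  assumes noncentral: "r \<otimes> r \<notin> group_centre G"
  shows "is_cayley_graph (twosided_cayley G L {r})"
proof -
  note stable = mult_even_stable[OF noncentral]
  obtain l where l: "l \<in> L" using L_nonempty by blast
  have proper: "even_part \<noteq> carrier G"
  proof
    assume "even_part = carrier G"
    then have "l \<otimes> (inv l \<otimes> r) \<in> L" using stable[OF l] l by simp
    then have "r \<in> L" using l by (simp add: inv_cancel_left)
    then show False using no_fixed_point[of \<one> r] by simp
  qed
  note odd = step_odd[OF proper]
  show ?thesis
  proof (rule is_cayley_graphI[of G "carrier G - even_part"])
    fix x y
    show "(x, y) \<in> parcs (twosided_cayley G L {r}) \<longleftrightarrow>
        x \<in> carrier G \<and> (\<exists>t\<in>carrier G - even_part. y = t \<otimes> x)" (is "?arc \<longleftrightarrow> ?odd")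
    proof
      assume ?arc
      then obtain m where m: "x \<in> carrier G" "m \<in> L" "y = inv m \<otimes> x \<otimes> r"
        by (auto simp: arc_iff)
      have "y = inv m \<otimes> x \<otimes> r \<otimes> inv x \<otimes> x" using m by (simp add: m_assoc)
      moreover have "inv m \<otimes> x \<otimes> r \<otimes> inv x \<notin> even_part"
        using odd[OF m(2)] m by (auto simp: even.mult_mem_iff even.inv_mem_iff)
      ultimately show ?odd using m by auto
    next
      assume ?odd
      then obtain t where t: "x \<in> carrier G" "t \<in> carrier G" "t \<notin> even_part" "y = t \<otimes> x"
        by auto
      have "inv l \<otimes> (x \<otimes> r \<otimes> inv x \<otimes> inv t) \<in> even_part"
        using odd[OF l] t l by (auto simp: even.mult_mem_iff even.inv_mem_iff)
      then have "l \<otimes> (inv l \<otimes> (x \<otimes> r \<otimes> inv x \<otimes> inv t)) \<in> L" by (rule stable[OF l])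
      then have "x \<otimes> r \<otimes> inv x \<otimes> inv t \<in> L" using t l by (simp add: inv_cancel_left)
      moreover have "y = inv (x \<otimes> r \<otimes> inv x \<otimes> inv t) \<otimes> x \<otimes> r"
        using t by (simp add: inv_mult_group m_assoc inv_cancel_left)
      ultimately show ?arc using t by (auto simp: arc_iff)
    qed
  qed (use sym_arcs irrefl_arcs in \<open>auto simp: group_axioms pverts_twosided_cayley\<close>)
qed

text \<open>
  For \<open>L = {a, b}\<close> every generator of the even part is a power of \<open>a\<^sup>-\<^sup>1 b\<close>, so the group
  is abelian.
\<close>
lemma central_if_card_two:
  assumes all: "even_part = carrier G" and two: "card L = 2"
  shows "r \<in> group_centre G"
proof -
  let ?S = "{inv l \<otimes> m | l m. l \<in> L \<and> m \<in> L}"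
  obtain a b where ab: "L = {a, b}" using two by (metis card_2_iff)
  have S: "?S \<subseteq> carrier G" by auto
  have S_ab: "s \<in> {\<one>, inv a \<otimes> b, inv (inv a \<otimes> b)}" if "s \<in> ?S" for s
    using that ab by (auto simp: inv_mult_group)
  have S_comm: "s \<otimes> t = t \<otimes> s" if "s \<in> ?S" "t \<in> ?S" for s t
    using S_ab[OF that(1)] S_ab[OF that(2)] ab L_carrier by auto
  have gen: "x \<in> generate G ?S" if "x \<in> carrier G" for x
    using that all by (simp add: even_part_def)
  have comm: "s \<otimes> x = x \<otimes> s" if "s \<in> ?S" "x \<in> carrier G" for s x
    using generate_commute[OF S _ S_comm gen] that S by blast
  have "r \<otimes> x = x \<otimes> r" if "x \<in> carrier G" for x
    by (rule generate_commute[OF S r_carrier comm[OF _ r_carrier, symmetric] gen[OF that]])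
  then show ?thesis by (simp add: group_centre_def)
qed

lemma generate_L_if_even_part_all:
  assumes "even_part = carrier G"
  shows "generate G L = carrier G"
proof
  show "generate G L \<subseteq> carrier G" by (rule generate_incl[OF L_carrier])
  have "even_part \<subseteq> generate G L"
    unfolding even_part_def
  proof (rule generate_subgroup_incl[OF _ generate_is_subgroup[OF L_carrier]])
    show "{inv l \<otimes> m |l m. l \<in> L \<and> m \<in> L} \<subseteq> generate G L"
      by (auto intro: generate.intros)
  qed
  then show "carrier G \<subseteq> generate G L" using assms by simp
qed

text \<open>
  An element \<open>g\<^sup>-\<^sup>1 r g\<close> of \<open>L\<close> would give a loop at \<open>g\<^sup>-\<^sup>1\<close>.
\<close>
lemma L_Int_conj_class: "L \<inter> conj_class G r = {}"
proof -
  have "inv g \<otimes> r \<otimes> g \<notin> L" if g: "g \<in> carrier G" for g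
  proof
    assume "inv g \<otimes> r \<otimes> g \<in> L"
    then have "inv (inv g \<otimes> r \<otimes> g) \<otimes> inv g \<otimes> r \<noteq> inv g" using no_fixed_point g by blast
    then show False using g by (simp add: inv_mult_group m_assoc inv_cancel_left)
  qed
  then show ?thesis by (auto simp: conj_class_def)
qed

lemma conj_class_Int_centre:
  assumes "r \<notin> group_centre G"
  shows "conj_class G r \<inter> group_centre G = {}"
proof -
  have "r \<in> group_centre G" if g: "g \<in> carrier G" and z: "inv g \<otimes> r \<otimes> g \<in> group_centre G" for g
  proof -
    have "inv g \<otimes> r \<otimes> g \<otimes> inv g = inv g \<otimes> (inv g \<otimes> r \<otimes> g)"
      using g z by (simp add: group_centre_def)
    then have "r = inv g \<otimes> r \<otimes> g" using g by (simp add: m_assoc)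
    then show ?thesis using z by simp
  qed
  then show ?thesis using assms by (auto simp: conj_class_def)
qed

lemma cayley_or_exceptional:
  assumes "\<not> is_cayley_graph (twosided_cayley G L {r})"
  shows "r \<notin> group_centre G" "r \<otimes> r \<in> group_centre G" "odd (card L)" "generate G L = carrier G"
proof -
  show r: "r \<notin> group_centre G" using assms is_cayley_graph_central by blast
  show "r \<otimes> r \<in> group_centre G" using assms is_cayley_graph_square_noncentral by blast
  then have all: "even_part = carrier G" using assms is_cayley_graph_square_central by blast
  then show "generate G L = carrier G" by (rule generate_L_if_even_part_all)
  have "card L \<noteq> 2" using central_if_card_two[OF all] r by blast
  then show "odd (card L)" using prime_card by (metis prime_odd_nat prime_ge_2_nat le_neq_implies_less)
qed

lemma is_cayley_graph_comm_group:
  assumes "comm_group G"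
  shows "is_cayley_graph (twosided_cayley G L {r})"
proof -
  interpret comm_group G by fact
  have "r \<in> group_centre G" by (auto simp: group_centre_def m_comm)
  then show ?thesis by (rule is_cayley_graph_central)
qed

lemma is_cayley_graph_dihedral_group:
  assumes n: "odd n" and iso: "G \<cong> dihedral_group n"
  shows "is_cayley_graph (twosided_cayley G L {r})"
proof (rule ccontr)
  assume "\<not> ?thesis"
  note exceptional = cayley_or_exceptional[OF this]
  have "generate G L \<noteq> carrier G"
    by (rule generate_proper_dihedral_group[OF group_axioms n iso r_carrier
          exceptional(1,2) L_carrier L_Int_conj_class])
  then show False using exceptional(4) by blast
qed

end

lemma singleton_twosided_cayley_swap:
  fixes G (structure)
  assumes "group G" and LR: "L \<subseteq> carrier G" "r \<in> carrier G" and "prime (card L)"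
    and sym: "sym (parcs (twosided_cayley G {r} L))"
    and irrefl: "irrefl (parcs (twosided_cayley G {r} L))"
    and connected: "connected (with_proj (twosided_cayley G {r} L))"
  shows "singleton_twosided_cayley G L r"
proof -
  interpret group G by fact
  have r: "{r} \<subseteq> carrier G" using LR by simp
  note swap = parcs_twosided_cayley_swap[OF group_axioms r LR(1)]
  have "sym (parcs (twosided_cayley G L {r}))"
  proof (rule symI)
    fix x y assume "(x, y) \<in> parcs (twosided_cayley G L {r})"
    then obtain a b where ab: "(a, b) \<in> parcs (twosided_cayley G {r} L)" "x = inv a" "y = inv b"
      unfolding swap by auto
    then have "(b, a) \<in> parcs (twosided_cayley G {r} L)" using sym by (auto dest: symD)
    then show "(y, x) \<in> parcs (twosided_cayley G L {r})"
      unfolding swap ab(2,3) by (rule rev_image_eqI) simp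
  qed
  moreover have "irrefl (parcs (twosided_cayley G L {r}))"
  proof (rule irreflI, rule notI)
    fix x assume "(x, x) \<in> parcs (twosided_cayley G L {r})"
    then obtain a b where ab: "(a, b) \<in> parcs (twosided_cayley G {r} L)" "inv a = inv b"
      unfolding swap by auto
    then have "a \<in> carrier G" "b \<in> carrier G" by (auto simp: twosided_cayley_def)
    then have "a = b" using ab(2) by (metis inv_inv)
    then show False using ab(1) irrefl by (auto simp: irrefl_def)
  qed
  moreover have "connected (with_proj (twosided_cayley G L {r}))"
    using connected_digraph_iso[OF digraph_iso_twosided_cayley_swap[OF group_axioms r LR(1)] connected] .
  ultimately show ?thesis
    using assms by unfold_locales auto
qed

section \<open>Prime valency\<close>

theorem theorem1p8:
  fixes G :: "('a, 'b) monoid_scheme" and L R :: "'a set" and p :: nat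
  assumes "group G"
    and "twosided_cayley_property G L R"
    and "connected (with_proj (twosided_cayley G L R))"
    and "prime p"
    and "regular_of_valency (twosided_cayley G L R) p"
  shows "(is_cayley_graph (twosided_cayley G L R) \<or>
          (odd p \<and>
           (\<exists>(L', R') \<in> {(L, R), (R, L)}. \<exists>r\<in>carrier G. \<exists>C.
              R' = {r} \<and> C = conj_class G r \<and> C \<inter> group_centre G = {} \<and>
              generate G L' = carrier G \<and> card L' = p \<and> L' \<inter> C = {})))
       \<and> ((comm_group G \<or> (\<exists>n. odd n \<and> G \<cong> dihedral_group n)) \<longrightarrow>
           is_cayley_graph (twosided_cayley G L R))"
proof -
  have LR: "L \<subseteq> carrier G" "R \<subseteq> carrier G"
    using assms(2) by (auto simp: twosided_cayley_property_def)
  note sym = sym_twosided_cayley[OF assms(1,2)]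
  note irrefl = irrefl_twosided_cayley[OF assms(1,2)]
  have "card L * card R = p"
    by (rule card_mult_card_eq_valency[OF assms(1,2,5)])
  then have "card R = 1 \<and> card L = p \<or> card L = 1 \<and> card R = p"
    using assms(4) by (metis prime_product mult.commute mult_1)
  then obtain L' r where L'r: "(L', {r}) \<in> {(L, R), (R, L)}" and card: "card L' = p"
    by (metis card_1_singletonE insertCI)
  have sub: "L' \<subseteq> carrier G" "r \<in> carrier G" using L'r LR by auto
  interpret singleton_twosided_cayley G L' r
  proof (cases "L' = L \<and> {r} = R")
    case True
    then show "singleton_twosided_cayley G L' r"
      using assms sub card sym irrefl
      by (auto simp: singleton_twosided_cayley_def singleton_twosided_cayley_axioms_def)
  next
    case False
    then have "L = {r}" "R = L'" using L'r by auto
    then show "singleton_twosided_cayley G L' r"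
      using assms sub card sym irrefl by (intro singleton_twosided_cayley_swap) auto
  qed
  have cayley: "is_cayley_graph (twosided_cayley G L R)"
    if "is_cayley_graph (twosided_cayley G L' {r})"
  proof (cases "L' = L \<and> {r} = R")
    case True
    then show ?thesis using that by simp
  next
    case False
    then have "L = {r}" "R = L'" using L'r by auto
    then show ?thesis
      using is_cayley_graph_digraph_iso[OF digraph_iso_twosided_cayley_swap that] LR assms(1) by simp
  qed
  have "odd p \<and> (\<exists>(L', R') \<in> {(L, R), (R, L)}. \<exists>r\<in>carrier G. \<exists>C.
      R' = {r} \<and> C = conj_class G r \<and> C \<inter> group_centre G = {} \<and>
      generate G L' = carrier G \<and> card L' = p \<and> L' \<inter> C = {})"
    if "\<not> is_cayley_graph (twosided_cayley G L R)"
  proof -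
    have not_cayley: "\<not> is_cayley_graph (twosided_cayley G L' {r})" using that cayley by blast
    note exceptional = cayley_or_exceptional[OF not_cayley]
    have "\<exists>s\<in>carrier G. \<exists>C. {r} = {s} \<and> C = conj_class G s \<and> C \<inter> group_centre G = {} \<and>
        generate G L' = carrier G \<and> card L' = p \<and> L' \<inter> C = {}"
      using exceptional(4) conj_class_Int_centre[OF exceptional(1)] L_Int_conj_class card
      by (intro bexI[of _ r] exI[of _ "conj_class G r"]) auto
    then show ?thesis using L'r exceptional(3) card by blast
  qed
  then show ?thesis
    using cayley is_cayley_graph_comm_group is_cayley_graph_dihedral_group by blast
qed

end
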